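(* Let $\mathbb{E}_1,\mathbb{E}_2$ be Euclidean spaces, let $g:\mathbb{E}_2\to\mathbb{R}\cup\{+\infty\}$ be lower semicontinuous, proper and convex, and let $F:\mathbb{E}_1\to\mathbb{E}_2^\bullet$ be proper and $(-\mathrm{hzn}\,g)$-convex such that $$F(\mathrm{ri}(\mathrm{dom}\,F))\cap\mathrm{ri}(\mathrm{dom}\,g)\neq\emptyset.$$ Then, for all $p\in\mathbb{E}_1$, $$(g\circ F)^*(p)=\min_{v\in\mathbb{E}_2}\{g^*(v)+\langle v,F\rangle^*(p)\}$$ (the minimum is attained, possibly with value $+\infty$), and $$\partial(g\circ F)(\bar x)=\bigcup_{v\in\partial g(F(\bar x))}\partial\langle v,F\rangle(\bar x)\qquad(\bar x\in\mathrm{dom}(g\circ F)).$$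
   Context: A Euclidean space is a finite-dimensional real inner product space. The horizon cone $\mathrm{hzn}\,g$ of a closed, proper, convex $g$ is the recession cone $\{w : y+tw\in \mathrm{lev}_g(\alpha)\ \forall t\ge0,\ \forall y\in\mathrm{lev}_g(\alpha)\}$ of any nonempty sublevel set $\mathrm{lev}_g(\alpha)=\{y : g(y)\le\alpha\}$ (independent of $\alpha$). $\mathbb{E}_2^\bullet=\mathbb{E}_2\cup\{+\infty_\bullet\}$, where $+\infty_\bullet$ is an adjoined largest element. For $F:\mathbb{E}_1\to\mathbb{E}_2^\bullet$: $\mathrm{dom}\,F=\{x : F(x)\in\mathbb{E}_2\}$, $F$ is proper if $\mathrm{dom}\,F\ne\emptyset$, and for a cone $K$, $F$ is $K$-convex if $\{(x,v)\in\mathbb{E}_1\times\mathbb{E}_2 : x\in\mathrm{dom}\,F,\ v-F(x)\in K\}$ is convex. $(g\circ F)(x)=g(F(x))$ if $x\in\mathrm{dom}\,F$ and $+\infty$ otherwise; $\langle v,F\rangle(x)=\langle v,F(x)\rangle$ if $x\in\mathrm{dom}\,F$ and $+\infty$ otherwise (also for $v=0$). $f^*(y)=\sup_x\{\langle y,x\rangle-f(x)\}$ is the Fenchel conjugate; $\partial f(\bar x)=\{v : f(\bar x)+\langle v,x-\bar x\rangle\le f(x)\ \forall x\}$ is the subdifferential; $\mathrm{ri}$ is the relative interior. *)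

theory Defs
  imports "HOL-Analysis.Analysis"
begin

subsection \<open>Extended-real-valued functions\<close>

definition edom :: "('a \<Rightarrow> ereal) \<Rightarrow> 'a set" where
  "edom f = {x. f x < \<infinity>}"

definition proper_fun :: "('a \<Rightarrow> ereal) \<Rightarrow> bool" where
  "proper_fun f \<longleftrightarrow> edom f \<noteq> {} \<and> (\<forall>x. f x \<noteq> -\<infinity>)"

definition lsc_fun :: "('a::topological_space \<Rightarrow> ereal) \<Rightarrow> bool" where
  "lsc_fun f \<longleftrightarrow> (\<forall>x. f x \<le> Liminf (at x) f)"

text \<open>Convexity of the epigraph; this avoids the undefined sum of \<open>\<infinity>\<close> and \<open>-\<infinity>\<close>.\<close>

definition convex_fun :: "('a::real_vector \<Rightarrow> ereal) \<Rightarrow> bool" where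
  "convex_fun f \<longleftrightarrow> convex {(x, r::real). f x \<le> ereal r}"

definition lev :: "('a \<Rightarrow> ereal) \<Rightarrow> real \<Rightarrow> 'a set" where
  "lev f \<alpha> = {x. f x \<le> ereal \<alpha>}"

definition fenchel_conj :: "('a::real_inner \<Rightarrow> ereal) \<Rightarrow> 'a \<Rightarrow> ereal" where
  "fenchel_conj f y = (SUP x. ereal (y \<bullet> x) - f x)"

definition subdiff :: "('a::real_inner \<Rightarrow> ereal) \<Rightarrow> 'a \<Rightarrow> 'a set" where
  "subdiff f x0 = {v. \<forall>x. f x0 + ereal (v \<bullet> (x - x0)) \<le> f x}"

definition recession_cone :: "'a::real_vector set \<Rightarrow> 'a set" where
  "recession_cone S = {w. \<forall>y\<in>S. \<forall>t\<ge>0. y + t *\<^sub>R w \<in> S}"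

text \<open>For closed, proper, convex functions all choices of a nonempty sublevel set give the same
  cone; see \<open>hzn_eq\<close> below.\<close>

definition hzn :: "('a::real_vector \<Rightarrow> ereal) \<Rightarrow> 'a set" where
  "hzn g = recession_cone (lev g (SOME \<alpha>. lev g \<alpha> \<noteq> {}))"

subsection \<open>Maps into a space with an adjoined largest element\<close>

text \<open>The codomain with the adjoined element is \<open>'b option\<close>, with \<open>None\<close> as the adjoined element,
  so the effective domain of \<open>F\<close> is \<open>dom F\<close>.\<close>

definition cone_convex :: "'b set \<Rightarrow> ('a::real_vector \<Rightarrow> 'b::real_vector option) \<Rightarrow> bool" where
  "cone_convex K F \<longleftrightarrow> convex {(x, v). x \<in> dom F \<and> v - the (F x) \<in> K}"

definition ecomp :: "('b \<Rightarrow> ereal) \<Rightarrow> ('a \<Rightarrow> 'b option) \<Rightarrow> 'a \<Rightarrow> ereal" where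
  "ecomp g F x = (case F x of None \<Rightarrow> \<infinity> | Some y \<Rightarrow> g y)"

definition scalarize :: "'b::real_inner \<Rightarrow> ('a \<Rightarrow> 'b option) \<Rightarrow> 'a \<Rightarrow> ereal" where
  "scalarize v F x = (case F x of None \<Rightarrow> \<infinity> | Some y \<Rightarrow> ereal (v \<bullet> y))"

subsection \<open>Independence of the horizon cone from the sublevel set\<close>

lemma lsc_fun_limit_le:
  fixes f :: "'a::real_normed_vector \<Rightarrow> ereal"
  assumes lsc: "lsc_fun f" and lim: "X \<longlonglongrightarrow> x"
    and le: "\<And>n. f (X n) \<le> ereal (b n)" and b: "b \<longlonglongrightarrow> \<beta>"
  shows "f x \<le> ereal \<beta>"
proof (rule ccontr)
  assume "\<not> f x \<le> ereal \<beta>"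
  then have "ereal \<beta> < f x" by simp
  then obtain r where r: "ereal \<beta> < ereal r" "ereal r < f x"
    using ereal_dense2 by blast
  have "ereal r < Liminf (at x) f"
    using r(2) lsc by (auto simp: lsc_fun_def intro: less_le_trans)
  then have "\<forall>\<^sub>F y in at x. ereal r < f y"
    by (rule less_LiminfD)
  then have "\<forall>\<^sub>F y in nhds x. ereal r < f y"
    using r(2) by (auto simp: eventually_at_filter elim!: eventually_mono)
  then have 1: "\<forall>\<^sub>F n in sequentially. ereal r < f (X n)"
    using lim by (rule eventually_compose_filterlim)
  have 2: "\<forall>\<^sub>F n in sequentially. b n < r"
    using b r(1) by (auto intro: order_tendstoD)
  have "\<forall>\<^sub>F n in sequentially. False"
    using 1 2
  proof eventually_elim
    case (elim n)
    have "ereal r < ereal (b n)" using elim(1) le[of n] by (rule less_le_trans)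
    with elim(2) show ?case by simp
  qed
  then show False by simp
qed

lemma recession_cone_lev_subset:
  fixes g :: "'a::real_normed_vector \<Rightarrow> ereal"
  assumes "lsc_fun g" "convex_fun g" "lev g \<alpha> \<noteq> {}"
  shows "recession_cone (lev g \<alpha>) \<subseteq> recession_cone (lev g \<beta>)"
proof
  fix w assume w: "w \<in> recession_cone (lev g \<alpha>)"
  obtain z where z: "z \<in> lev g \<alpha>" using assms(3) by blast
  show "w \<in> recession_cone (lev g \<beta>)"
    unfolding recession_cone_def
  proof (intro CollectI ballI allI impI)
    fix y and t :: real assume y: "y \<in> lev g \<beta>" and t: "t \<ge> 0"
    define e where "e n = 1 / real (Suc n)" for n
    define X where "X n = (1 - e n) *\<^sub>R y + e n *\<^sub>R (z + (real (Suc n) * t) *\<^sub>R w)" for n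
    define b where "b n = (1 - e n) * \<beta> + e n * \<alpha>" for n
    have e: "e n \<ge> 0" "e n \<le> 1" for n by (auto simp: e_def)
    have e0: "e \<longlonglongrightarrow> 0"
      unfolding e_def using LIMSEQ_inverse_real_of_nat by (simp add: inverse_eq_divide)
    have X: "X = (\<lambda>n. (1 - e n) *\<^sub>R y + e n *\<^sub>R z + t *\<^sub>R w)"
      by (rule ext) (simp add: X_def e_def scaleR_add_right)
    have "(\<lambda>n. (1 - e n) *\<^sub>R y + e n *\<^sub>R z + t *\<^sub>R w) \<longlonglongrightarrow> (1 - 0) *\<^sub>R y + 0 *\<^sub>R z + t *\<^sub>R w"
      by (intro tendsto_intros e0)
    then have limX: "X \<longlonglongrightarrow> y + t *\<^sub>R w" by (simp add: X)
    have "(\<lambda>n. (1 - e n) * \<beta> + e n * \<alpha>) \<longlonglongrightarrow> (1 - 0) * \<beta> + 0 * \<alpha>"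
      by (intro tendsto_intros e0)
    then have limb: "b \<longlonglongrightarrow> \<beta>" unfolding b_def by simp
    have "g (X n) \<le> ereal (b n)" for n
    proof -
      have "z + (real (Suc n) * t) *\<^sub>R w \<in> lev g \<alpha>"
        using w z t unfolding recession_cone_def by simp
      then have "(z + (real (Suc n) * t) *\<^sub>R w, \<alpha>) \<in> {(x, r). g x \<le> ereal r}"
        by (simp add: lev_def)
      moreover have "(y, \<beta>) \<in> {(x, r). g x \<le> ereal r}"
        using y by (simp add: lev_def)
      ultimately have "(1 - e n) *\<^sub>R (y, \<beta>) + e n *\<^sub>R (z + (real (Suc n) * t) *\<^sub>R w, \<alpha>)
          \<in> {(x, r). g x \<le> ereal r}"
        using assms(2) e[of n] unfolding convex_fun_def
        by (intro convexD) auto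
      then show ?thesis by (simp add: X_def b_def)
    qed
    from lsc_fun_limit_le[OF assms(1) limX this limb]
    show "y + t *\<^sub>R w \<in> lev g \<beta>" by (simp add: lev_def)
  qed
qed

lemma hzn_eq:
  fixes g :: "'a::real_normed_vector \<Rightarrow> ereal"
  assumes "lsc_fun g" "convex_fun g" "lev g \<alpha> \<noteq> {}"
  shows "hzn g = recession_cone (lev g \<alpha>)"
proof -
  have "lev g (SOME \<alpha>. lev g \<alpha> \<noteq> {}) \<noteq> {}"
    using assms(3) by (rule someI)
  then show ?thesis
    unfolding hzn_def using recession_cone_lev_subset assms by blast
qed

end

(*
  The inequality "\<le>" in the conjugate formula is Fenchel-Young.  For the converse put K = - hzn g and
  let E be the K-epigraph of F.  The set A of all (y - w, r - <p,x>) with (y,r) in epi g and (x,w) in E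
  is convex, and because g does not increase along hzn g it meets {0} x R in a set with infimum
  - (g o F)*(p).  The relative interior hypothesis puts some (0,s) into ri A, so a hyperplane
  supporting A at (0, - (g o F)*(p)) is not vertical, and its normalised slope is the minimising v.
  The same v, taken at the p of a subgradient of g o F, gives the subdifferential formula.
*)
theory Submission
  imports Defs
begin

section \<open>Conjugates, epigraphs and weak duality\<close>

text \<open>Testing against points \<open>(x, r)\<close> of the epigraph keeps the arithmetic real,
  so that later bounds on conjugates need no case split on infinite values of
  \<open>f\<close>.\<close>

lemma fenchel_conj_le_iff:
  "fenchel_conj f p \<le> ereal a \<longleftrightarrow> (\<forall>x r. f x \<le> ereal r \<longrightarrow> p \<bullet> x - r \<le> a)"
proof -
  have "ereal (p \<bullet> x) - f x \<le> ereal a \<longleftrightarrow> (\<forall>r. f x \<le> ereal r \<longrightarrow> p \<bullet> x - r \<le> a)" for x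
  proof (cases "f x")
    case (real s)
    show ?thesis
    proof
      show "\<forall>r. f x \<le> ereal r \<longrightarrow> p \<bullet> x - r \<le> a" if "ereal (p \<bullet> x) - f x \<le> ereal a"
        using that real by auto
      show "ereal (p \<bullet> x) - f x \<le> ereal a" if "\<forall>r. f x \<le> ereal r \<longrightarrow> p \<bullet> x - r \<le> a"
        using that[rule_format, of s] real by auto
    qed
  next
    case MInf
    \<comment> \<open>Where \<open>f x\<close> is \<open>-\<infinity>\<close>, every real
      \<open>r\<close> is admissible; this one makes \<open>p \<bullet> x - r\<close> equal to
      \<open>a + 1\<close>.\<close>
    have "\<not> p \<bullet> x - (p \<bullet> x - a - 1) \<le> a" by simp
    then have "\<not> (\<forall>r. p \<bullet> x - r \<le> a)" by blast
    then show ?thesis using MInf by simp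
  qed auto
  then show ?thesis unfolding fenchel_conj_def SUP_le_iff by blast
qed

lemma fenchel_conj_neq_MInf:
  assumes "f x < \<infinity>"
  shows "fenchel_conj f p \<noteq> -\<infinity>"
proof -
  have "ereal (p \<bullet> x) - f x \<le> fenchel_conj f p"
    unfolding fenchel_conj_def by (rule SUP_upper) simp
  then show ?thesis using assms by (cases "f x") auto
qed

lemma ecomp_le_iff: "ecomp g F x \<le> ereal r \<longleftrightarrow> (\<exists>y. F x = Some y \<and> g y \<le> ereal r)"
  by (auto simp: ecomp_def split: option.splits)

lemma scalarize_le_iff:
  "scalarize v F x \<le> ereal r \<longleftrightarrow> (\<exists>y. F x = Some y \<and> v \<bullet> y \<le> r)"
  by (auto simp: scalarize_def split: option.splits)

text \<open>Add the Fenchel-Young inequalities of \<open>g\<close> at \<open>z = F x\<close> and of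
  \<open>scalarize v F\<close> at \<open>x\<close>: the terms \<open>v \<bullet> z\<close>
  cancel.\<close>

lemma fenchel_conj_ecomp_le:
  "fenchel_conj (ecomp g F) p \<le> fenchel_conj g v + fenchel_conj (scalarize v F) p"
  unfolding fenchel_conj_def[of "ecomp g F"]
proof (rule SUP_least)
  fix x
  show "ereal (p \<bullet> x) - ecomp g F x \<le> fenchel_conj g v + fenchel_conj (scalarize v F) p"
  proof (cases "F x")
    case (Some z)
    have "ereal (v \<bullet> z) - g z \<le> fenchel_conj g v"
      unfolding fenchel_conj_def by (rule SUP_upper) simp
    moreover have "ereal (p \<bullet> x) - scalarize v F x \<le> fenchel_conj (scalarize v F) p"
      unfolding fenchel_conj_def by (rule SUP_upper) simp
    ultimately have "(ereal (v \<bullet> z) - g z) + (ereal (p \<bullet> x) - scalarize v F x)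
        \<le> fenchel_conj g v + fenchel_conj (scalarize v F) p"
      by (rule add_mono)
    then show ?thesis using Some
      by (cases "g z") (auto simp: ecomp_def scalarize_def)
  qed (simp add: ecomp_def)
qed

section \<open>Recession cones and the horizon cone\<close>

lemma recession_cone_zero: "0 \<in> recession_cone S"
  by (simp add: recession_cone_def)

lemma convex_recession_cone: "convex (recession_cone S)"
proof (rule convexI)
  fix a b and u v :: real
  assume a: "a \<in> recession_cone S" and b: "b \<in> recession_cone S" and uv: "0 \<le> u" "0 \<le> v"
  show "u *\<^sub>R a + v *\<^sub>R b \<in> recession_cone S"
    unfolding recession_cone_def
  proof (intro CollectI ballI allI impI)
    fix y and t :: real assume y: "y \<in> S" and t: "0 \<le> t"
    have "y + (t * u) *\<^sub>R a \<in> S"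
      using a y t uv by (simp add: recession_cone_def)
    then have "(y + (t * u) *\<^sub>R a) + (t * v) *\<^sub>R b \<in> S"
      using b t uv by (simp add: recession_cone_def)
    then show "y + t *\<^sub>R (u *\<^sub>R a + v *\<^sub>R b) \<in> S" by (simp add: algebra_simps)
  qed
qed

lemma zero_in_hzn: "0 \<in> hzn g"
  unfolding hzn_def by (rule recession_cone_zero)

lemma convex_hzn: "convex (hzn g)"
  unfolding hzn_def by (rule convex_recession_cone)

text \<open>The sublevel set at level \<open>r\<close> contains \<open>y\<close>, so it is nonempty
  and \<open>hzn g\<close> is its recession cone; the claim is the case
  \<open>t = 1\<close>.\<close>

lemma hzn_le:
  fixes g :: "'a::real_normed_vector \<Rightarrow> ereal"
  assumes "lsc_fun g" "convex_fun g" "w \<in> hzn g" "g y \<le> ereal r"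
  shows "g (y + w) \<le> ereal r"
proof -
  have y: "y \<in> lev g r" using assms(4) by (simp add: lev_def)
  then have "w \<in> recession_cone (lev g r)"
    using assms hzn_eq[of g r] by auto
  then have "y + 1 *\<^sub>R w \<in> lev g r"
    unfolding recession_cone_def using y zero_le_one by blast
  then show ?thesis by (simp add: lev_def)
qed

lemma edom_iff_le_real: "y \<in> edom g \<longleftrightarrow> (\<exists>r. g y \<le> ereal r)"
  by (cases "g y") (auto simp: edom_def)

lemma convex_edom:
  assumes "convex_fun g"
  shows "convex (edom g)"
proof -
  have "edom g = fst ` {(x, r::real). g x \<le> ereal r}"
    using edom_iff_le_real[of _ g] by (force simp: image_iff)
  then show ?thesis
    using convex_linear_image[OF linear_fst] assms by (auto simp: convex_fun_def)
qed

text \<open>As \<open>g\<close> does not increase along \<open>hzn g\<close>, the sum is no larger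
  than the domain. Writing the domain as a sum allows its relative interior to be split over the
  summands.\<close>

lemma edom_plus_hzn:
  fixes g :: "'a::real_normed_vector \<Rightarrow> ereal"
  assumes "lsc_fun g" "convex_fun g"
  shows "edom g + hzn g = edom g"
proof
  show "edom g + hzn g \<subseteq> edom g"
    using hzn_le[OF assms] by (auto simp: edom_iff_le_real elim!: set_plus_elim) blast
  show "edom g \<subseteq> edom g + hzn g"
    using set_plus_intro[OF _ zero_in_hzn, of _ "edom g" g] by auto
qed

section \<open>Relative interiors of epigraphs\<close>

text \<open>A point is in the relative interior of a convex set in a product iff its first component
  is in that of the projection and its second in that of the fibre. Here the fibre is convex and
  nonempty, so a suitable \<open>r\<close> exists.\<close>

lemma rel_interior_epigraph_fibre:
  fixes g :: "'a::euclidean_space \<Rightarrow> ereal"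
  assumes "convex_fun g" "y \<in> rel_interior (edom g)"
  obtains r where "(y, r) \<in> rel_interior {(x, r::real). g x \<le> ereal r}"
proof -
  let ?E = "{(x, r::real). g x \<le> ereal r}"
  have C: "convex ?E" using assms(1) by (simp add: convex_fun_def)
  have dom: "{y. {r. (y, r) \<in> ?E} \<noteq> {}} = edom g"
    by (auto simp: edom_iff_le_real)
  have ne: "{r. (y, r) \<in> ?E} \<noteq> {}"
    using rel_interior_subset assms(2) dom by blast
  have "convex {r. (y, r) \<in> ?E}"
  proof (rule convexI)
    fix r s u v :: real
    assume *: "r \<in> {r. (y, r) \<in> ?E}" "s \<in> {r. (y, r) \<in> ?E}" "0 \<le> u" "0 \<le> v" "u + v = 1"
    have "u *\<^sub>R (y, r) + v *\<^sub>R (y, s) \<in> ?E"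
      using * by (intro convexD[OF C]) auto
    then show "u *\<^sub>R r + v *\<^sub>R s \<in> {r. (y, r) \<in> ?E}"
      using * by (simp flip: scaleR_add_left)
  qed
  then obtain r where "r \<in> rel_interior {r. (y, r) \<in> ?E}"
    using ne rel_interior_eq_empty by blast
  then have "(y, r) \<in> rel_interior ?E"
    using rel_interior_projection[OF C refl, of y r] assms(2) dom by simp
  then show thesis by (rule that)
qed

text \<open>The same fibre criterion applies: the projection is \<open>dom F\<close> because
  \<open>0 \<in> K\<close>, and the fibre over \<open>x\<close> is the translate of \<open>K\<close>
  by \<open>the (F x)\<close>.\<close>

lemma rel_interior_cone_epigraph:
  fixes F :: "'a::euclidean_space \<Rightarrow> 'b::euclidean_space option"
  assumes "cone_convex K F" "0 \<in> K" "x \<in> rel_interior (dom F)" "k \<in> rel_interior K"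
  shows "(x, the (F x) + k) \<in> rel_interior {(x, v). x \<in> dom F \<and> v - the (F x) \<in> K}"
proof -
  let ?E = "{(x, v). x \<in> dom F \<and> v - the (F x) \<in> K}"
  have C: "convex ?E" using assms(1) by (simp add: cone_convex_def)
  have x: "x \<in> dom F" using assms(3) rel_interior_subset by blast
  have "(y, the (F y)) \<in> ?E" if "y \<in> dom F" for y
    using that assms(2) by simp
  then have dom: "{y. {v. (y, v) \<in> ?E} \<noteq> {}} = dom F" by blast
  have "{v. (x, v) \<in> ?E} = (+) (the (F x)) ` K"
    using x by (force simp: image_iff)
  then have "the (F x) + k \<in> rel_interior {v. (x, v) \<in> ?E}"
    using assms(4) by (simp add: rel_interior_translation)
  then show ?thesis
    using rel_interior_projection[OF C refl, of x "the (F x) + k"] assms(3) dom by simp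
qed

section \<open>Separation and the multiplier\<close>

text \<open>This is strong duality in real terms: \<open>x\<close> and \<open>(y, r)\<close> vary
  independently, so the two suprema in
  \<open>fenchel_conj g v + fenchel_conj (scalarize v F) p\<close> can be taken one after the
  other.\<close>

lemma conj_ecomp_multiplier:
  fixes g :: "'b::euclidean_space \<Rightarrow> ereal"
    and F :: "'a::euclidean_space \<Rightarrow> 'b option"
  assumes lsc: "lsc_fun g" and conv: "convex_fun g"
    and FK: "cone_convex (uminus ` hzn g) F"
    and ri: "(\<lambda>x. the (F x)) ` rel_interior (dom F) \<inter> rel_interior (edom g) \<noteq> {}"
    and \<alpha>: "fenchel_conj (ecomp g F) p = ereal \<alpha>"
  obtains v where "\<And>x z y r. F x = Some z \<Longrightarrow> g y \<le> ereal r \<Longrightarrow>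
    (p \<bullet> x - v \<bullet> z) + (v \<bullet> y - r) \<le> \<alpha>"
proof -
  define K where "K = uminus ` hzn g"
  define E where "E = {(x, v). x \<in> dom F \<and> v - the (F x) \<in> K}"
  define G where "G = {(y, r::real). g y \<le> ereal r}"
  \<comment> \<open>As a linear image of a product, \<open>A\<close> has a computable relative
    interior. The coordinate \<open>y - w\<close> measures the violation of the constraint
    \<open>y = w\<close>.\<close>
  define L :: "('b \<times> real) \<times> ('a \<times> 'b) \<Rightarrow> 'b \<times> real"
    where "L = (\<lambda>((y, r), (x, w)). (y - w, r - p \<bullet> x))"
  define A where "A = L ` (G \<times> E)"
  have K0: "0 \<in> K" using zero_in_hzn[of g] by (force simp: K_def)
  have convK: "convex K" unfolding K_def
    by (rule convex_linear_image[OF _ convex_hzn]) (auto intro: linear_uminus)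
  have convG: "convex G" using conv by (simp add: G_def convex_fun_def)
  have convE: "convex E" using FK by (simp add: E_def K_def cone_convex_def)
  have L: "linear L"
    by (rule linearI) (auto simp: L_def inner_add_right algebra_simps split: prod.splits)
  have convA: "convex A" unfolding A_def
    by (intro convex_linear_image[OF L] convex_Times convG convE)
  have riA: "rel_interior A = L ` (rel_interior G \<times> rel_interior E)"
    unfolding A_def rel_interior_Times[OF convG convE, symmetric]
    by (rule rel_interior_convex_linear_image[OF L convex_Times[OF convG convE], symmetric])
  have AI: "(y - z, r - p \<bullet> x) \<in> A" if "F x = Some z" "g y \<le> ereal r" for x z y r
  proof -
    have "((y, r), (x, z)) \<in> G \<times> E" using that K0 by (auto simp: G_def E_def)
    then have "L ((y, r), (x, z)) \<in> A" unfolding A_def by (rule imageI)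
    then show ?thesis by (simp add: L_def)
  qed
  have AE: "\<exists>y r x w. (y, r) \<in> G \<and> (x, w) \<in> E \<and> u = y - w \<and> s = r - p \<bullet> x"
    if us: "(u, s) \<in> A" for u s
  proof -
    from us obtain q where q: "q \<in> G \<times> E" "(u, s) = L q" unfolding A_def by blast
    obtain y r x w where "q = ((y, r), (x, w))" by (metis surj_pair)
    with q have "(y, r) \<in> G" "(x, w) \<in> E" "u = y - w" "s = r - p \<bullet> x"
      by (simp_all add: L_def)
    then show ?thesis by blast
  qed
  \<comment> \<open>Over 0 we have \<open>y = w\<close>, so \<open>the (F x) - y\<close> lies in
    \<open>hzn g\<close>, and moving along it from \<open>y\<close> to \<open>the (F x)\<close> does
    not increase \<open>g\<close>.\<close>
  have A0: "- \<alpha> \<le> s" if s: "(0, s) \<in> A" for s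
  proof -
    obtain y r x w where "(y, r) \<in> G" "(x, w) \<in> E" "0 = y - w" "s = r - p \<bullet> x"
      using AE[OF s] by blast
    then have *: "g y \<le> ereal r" "x \<in> dom F" "y - the (F x) \<in> K" "s = r - p \<bullet> x"
      by (simp_all add: G_def E_def)
    have "the (F x) - y \<in> hzn g"
      using *(3) unfolding K_def by (metis imageE minus_diff_eq minus_minus)
    from hzn_le[OF lsc conv this *(1)] have "g (the (F x)) \<le> ereal r" by simp
    then have "ecomp g F x \<le> ereal r" using *(2) by (auto simp: ecomp_le_iff)
    moreover have "fenchel_conj (ecomp g F) p \<le> ereal \<alpha>" using \<alpha> by simp
    ultimately have "p \<bullet> x - r \<le> \<alpha>" by (auto simp: fenchel_conj_le_iff)
    then show ?thesis using *(4) by simp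
  qed
  have approx: "\<exists>s. (0, s) \<in> A \<and> s < - \<alpha> + e" if "e > 0" for e
  proof -
    have "\<not> fenchel_conj (ecomp g F) p \<le> ereal (\<alpha> - e)" using \<alpha> that by simp
    then obtain x r where *: "ecomp g F x \<le> ereal r" "\<not> p \<bullet> x - r \<le> \<alpha> - e"
      by (auto simp: fenchel_conj_le_iff)
    then obtain z where "F x = Some z" "g z \<le> ereal r" by (auto simp: ecomp_le_iff)
    from AI[OF this] * show ?thesis by (intro exI[of _ "r - p \<bullet> x"]) auto
  qed
  have up: "(u, s') \<in> A" if us: "(u, s) \<in> A" and le: "s \<le> s'" for u s s'
  proof -
    obtain y r x w where *: "(y, r) \<in> G" "(x, w) \<in> E" "u = y - w" "s = r - p \<bullet> x"
      using AE[OF us] by blast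
    have "(y, s' + p \<bullet> x) \<in> G"
      using * le unfolding G_def by (auto elim: order_trans)
    then have "L ((y, s' + p \<bullet> x), (x, w)) \<in> A" unfolding A_def using * by blast
    then show ?thesis using * by (simp add: L_def)
  qed
  obtain s0 where s0: "(0, s0) \<in> rel_interior A"
  proof -
    obtain x0 where x0: "x0 \<in> rel_interior (dom F)" "the (F x0) \<in> rel_interior (edom g)"
      using ri by auto
    \<comment> \<open>\<open>F x0\<close> need not be the second component of a relative interior point of \<open>E\<close>; since
      \<open>edom g\<close> absorbs \<open>hzn g\<close>, it can be shifted into \<open>F x0 + ri K\<close> without leaving
      \<open>ri (edom g)\<close>.\<close>
    have "the (F x0) \<in> rel_interior (edom g + hzn g)"
      using x0(2) by (simp add: edom_plus_hzn[OF lsc conv])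
    then have "the (F x0) \<in> rel_interior (edom g) + rel_interior (hzn g)"
      by (simp add: rel_interior_sum[OF convex_edom[OF conv] convex_hzn])
    then obtain y1 h where y1: "y1 \<in> rel_interior (edom g)" and h: "h \<in> rel_interior (hzn g)"
      and eq: "the (F x0) = y1 + h"
      by (rule set_plus_elim)
    have "rel_interior K = uminus ` rel_interior (hzn g)" unfolding K_def
      by (rule rel_interior_convex_linear_image[symmetric])
        (auto intro: linear_uminus convex_hzn)
    then have "- h \<in> rel_interior K" using h by simp
    from rel_interior_cone_epigraph[OF FK[folded K_def] K0 x0(1) this]
    have E1: "(x0, y1) \<in> rel_interior E" by (simp add: eq E_def)
    obtain r where "(y1, r) \<in> rel_interior G"
      using rel_interior_epigraph_fibre[OF conv y1] unfolding G_def .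
    \<comment> \<open>The same \<open>y1\<close> occurs in both points, so the first coordinate of
      the image is 0.\<close>
    then have "L ((y1, r), (x0, y1)) \<in> rel_interior A" unfolding riA using E1 by blast
    then show thesis using that by (simp add: L_def)
  qed
  have s0A: "(0, s0) \<in> A" using s0 rel_interior_subset by blast
  have cl: "(0, - \<alpha>) \<in> closure A"
    unfolding closure_approachable
  proof (intro allI impI)
    fix e :: real assume "e > 0"
    then obtain s where "(0, s) \<in> A" "s < - \<alpha> + e" using approx by blast
    moreover from this have "- \<alpha> \<le> s" using A0 by blast
    ultimately show "\<exists>y\<in>A. dist y (0, - \<alpha>) < e"
      by (intro bexI[of _ "(0, s)"]) (auto simp: dist_Pair_Pair dist_real_def)
  qed
  have nri: "(0, - \<alpha>) \<notin> rel_interior A"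
  proof
    assume q: "(0, - \<alpha>) \<in> rel_interior A"
    \<comment> \<open>A point of \<open>A\<close> over 0 strictly above \<open>- \<alpha>\<close>.
      Were \<open>(0, - \<alpha>)\<close> in the relative interior, the segment from
      \<open>(0, s)\<close> could be prolonged past it inside \<open>A\<close>, contradicting
      \<open>A0\<close>.\<close>
    define s where "s = max s0 (1 - \<alpha>)"
    have sA: "(0, s) \<in> A" using up[OF s0A, of s] by (simp add: s_def)
    have "A \<noteq> {}" using s0A by blast
    from q[unfolded convex_rel_interior_iff[OF convA this]] sA
    obtain e where e: "e > 1" "(1 - e) *\<^sub>R (0, s) + e *\<^sub>R (0, - \<alpha>) \<in> A" by blast
    then have "- \<alpha> \<le> (1 - e) * s - e * \<alpha>" using A0 by simp
    then have "(e - 1) * (s + \<alpha>) \<le> 0" by (simp add: algebra_simps)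
    moreover have "s + \<alpha> > 0" by (simp add: s_def)
    ultimately show False using e(1) by (simp add: mult_le_0_iff)
  qed
  obtain a where a: "\<And>q. q \<in> closure A \<Longrightarrow> a \<bullet> (0, - \<alpha>) \<le> a \<bullet> q"
      "\<And>q. q \<in> rel_interior A \<Longrightarrow> a \<bullet> (0, - \<alpha>) < a \<bullet> q"
    using supporting_hyperplane_relative_frontier[OF convA cl nri] by metis
  obtain b c where bc: "a = (b, c)" by (cases a)
  \<comment> \<open>At \<open>(0, s0)\<close> the component \<open>b\<close> drops out, so
    strictness on the relative interior fixes the sign of \<open>c\<close>: the hyperplane is not
    vertical.\<close>
  have "c * (- \<alpha>) < c * s0" using a(2)[OF s0] by (simp add: bc)
  moreover have "- \<alpha> \<le> s0" using A0 s0A .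
  ultimately have c: "c > 0"
    by (smt (verit) mult_less_cancel_left)
  show thesis
  proof (rule that)
    fix x z y r assume *: "F x = Some z" "g y \<le> ereal r"
    have "(y - z, r - p \<bullet> x) \<in> closure A"
      using AI[OF *] closure_subset by blast
    from a(1)[OF this] have "c * (- \<alpha>) \<le> b \<bullet> (y - z) + c * (r - p \<bullet> x)" by (simp add: bc)
    \<comment> \<open>Dividing by \<open>c\<close> turns the normal \<open>(b, c)\<close> into
      \<open>(- v, 1)\<close>, where \<open>v\<close> is \<open>- b / c\<close>.\<close>
    then have "c * (- \<alpha>) / c \<le> (b \<bullet> (y - z) + c * (r - p \<bullet> x)) / c"
      using c by (intro divide_right_mono) auto
    then have "- \<alpha> \<le> (b \<bullet> (y - z)) / c + (r - p \<bullet> x)"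
      using c by (simp add: add_divide_distrib)
    then show "(p \<bullet> x - ((- 1 / c) *\<^sub>R b) \<bullet> z) + (((- 1 / c) *\<^sub>R b) \<bullet> y - r) \<le> \<alpha>"
      by (simp add: inner_diff_right diff_divide_distrib)
  qed
qed

section \<open>The conjugate and subdifferential formulas\<close>

theorem corollary20:
  fixes g :: "'b::euclidean_space \<Rightarrow> ereal"
    and F :: "'a::euclidean_space \<Rightarrow> 'b option"
  assumes "lsc_fun g" and "proper_fun g" and "convex_fun g"
    and "dom F \<noteq> {}"
    and "cone_convex (uminus ` hzn g) F"
    and "(\<lambda>x. the (F x)) ` rel_interior (dom F) \<inter> rel_interior (edom g) \<noteq> {}"
  shows "(\<forall>p. fenchel_conj (ecomp g F) p
                = (INF v. fenchel_conj g v + fenchel_conj (scalarize v F) p)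
            \<and> (\<exists>v0. fenchel_conj g v0 + fenchel_conj (scalarize v0 F) p
                = (INF v. fenchel_conj g v + fenchel_conj (scalarize v F) p)))
       \<and> (\<forall>x0 \<in> edom (ecomp g F).
            subdiff (ecomp g F) x0
              = (\<Union>v \<in> subdiff g (the (F x0)). subdiff (scalarize v F) x0))"
proof -
  note mult = conj_ecomp_multiplier[OF assms(1,3,5,6)]
  note g_finite = assms(2)[unfolded proper_fun_def]
  \<comment> \<open>\<open>y1\<close> and \<open>x2\<close> keep the conjugates of \<open>g\<close>
    and \<open>ecomp g F\<close> away from \<open>-\<infinity>\<close>; \<open>x1\<close> will bound
    the conjugate of \<open>g\<close> at the multiplier from above.\<close>
  obtain y1 where y1: "g y1 < \<infinity>" using g_finite by (auto simp: edom_def)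
  obtain x1 where "x1 \<in> dom F" using assms(4) by blast
  then obtain z1 where x1: "F x1 = Some z1" using domD by metis
  obtain x2 where x2: "ecomp g F x2 < \<infinity>"
  proof -
    obtain x where "x \<in> rel_interior (dom F)" "the (F x) \<in> rel_interior (edom g)"
      using assms(6) by auto
    then have "x \<in> dom F" "the (F x) \<in> edom g" using rel_interior_subset by blast+
    then have "ecomp g F x < \<infinity>" by (auto simp: ecomp_def edom_def)
    then show thesis by (rule that)
  qed
  have attained: "\<exists>v. fenchel_conj g v + fenchel_conj (scalarize v F) p \<le> fenchel_conj (ecomp g F) p" for p
  proof (cases "fenchel_conj (ecomp g F) p")
    case (real \<alpha>)
    obtain v where v: "\<And>x z y r. F x = Some z \<Longrightarrow> g y \<le> ereal r \<Longrightarrow>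
        (p \<bullet> x - v \<bullet> z) + (v \<bullet> y - r) \<le> \<alpha>"
      using mult[OF real] by blast
    \<comment> \<open>The supremum over \<open>y\<close> is taken first, with \<open>x\<close>
      fixed. It is a real number \<open>c\<close>, which can be moved to the other side before
      taking the supremum over \<open>x\<close>.\<close>
    have gv: "fenchel_conj g v \<le> ereal (\<alpha> - (p \<bullet> x - v \<bullet> z))" if "F x = Some z" for x z
      unfolding fenchel_conj_le_iff using v[OF that] by (simp add: algebra_simps)
    obtain c where c: "fenchel_conj g v = ereal c"
      using gv[OF x1] fenchel_conj_neq_MInf[of g y1 v] y1 by (cases "fenchel_conj g v") auto
    have "fenchel_conj (scalarize v F) p \<le> ereal (\<alpha> - c)"
      unfolding fenchel_conj_le_iff scalarize_le_iff using gv c by fastforce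
    then have "ereal c + fenchel_conj (scalarize v F) p \<le> ereal c + ereal (\<alpha> - c)"
      by (rule add_left_mono)
    then show ?thesis using real c by (intro exI[of _ v]) simp
  next
    case MInf
    then show ?thesis using fenchel_conj_neq_MInf[of "ecomp g F" x2 p] x2 by simp
  qed simp
  have conj: "fenchel_conj (ecomp g F) p = (INF v. fenchel_conj g v + fenchel_conj (scalarize v F) p)
      \<and> (\<exists>v0. fenchel_conj g v0 + fenchel_conj (scalarize v0 F) p
          = (INF v. fenchel_conj g v + fenchel_conj (scalarize v F) p))" for p
  proof -
    obtain v0 where v0: "fenchel_conj g v0 + fenchel_conj (scalarize v0 F) p
        \<le> fenchel_conj (ecomp g F) p"
      using attained by blast
    \<comment> \<open>Weak duality and the choice of \<open>v0\<close> close a cycle of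
      inequalities, so all three quantities agree.\<close>
    have "fenchel_conj (ecomp g F) p \<le> (INF v. fenchel_conj g v + fenchel_conj (scalarize v F) p)"
      by (rule INF_greatest) (rule fenchel_conj_ecomp_le)
    moreover have "(INF v. fenchel_conj g v + fenchel_conj (scalarize v F) p)
        \<le> fenchel_conj g v0 + fenchel_conj (scalarize v0 F) p"
      by (rule INF_lower) simp
    moreover note v0
    ultimately have "fenchel_conj (ecomp g F) p
          = (INF v. fenchel_conj g v + fenchel_conj (scalarize v F) p)"
      "fenchel_conj g v0 + fenchel_conj (scalarize v0 F) p
          = (INF v. fenchel_conj g v + fenchel_conj (scalarize v F) p)"
      by order+
    then show ?thesis by blast
  qed
  have "subdiff (ecomp g F) x0
      = (\<Union>v \<in> subdiff g (the (F x0)). subdiff (scalarize v F) x0)"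
    if x0: "x0 \<in> edom (ecomp g F)" for x0
  proof -
    obtain z0 where z0: "F x0 = Some z0" using x0
      by (auto simp: edom_def ecomp_def split: option.splits)
    obtain c where c: "g z0 = ereal c"
      using x0 g_finite z0 by (cases "g z0") (auto simp: edom_def ecomp_def)
    have "q \<in> (\<Union>v \<in> subdiff g z0. subdiff (scalarize v F) x0)"
      if q: "q \<in> subdiff (ecomp g F) x0" for q
    proof -
      have q': "c + q \<bullet> (x - x0) \<le> r" if "F x = Some z" "g z \<le> ereal r" for x z r
      proof -
        have "ecomp g F x0 + ereal (q \<bullet> (x - x0)) \<le> ecomp g F x"
          using q by (simp add: subdiff_def)
        also have "\<dots> \<le> ereal r" using that by (simp add: ecomp_def)
        finally have "ereal (c + q \<bullet> (x - x0)) \<le> ereal r"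
          using z0 c by (simp add: ecomp_def)
        then show ?thesis by simp
      qed
      \<comment> \<open>A subgradient gives equality in Fenchel-Young, so the conjugate at
        \<open>q\<close> is real and has a multiplier.\<close>
      have "fenchel_conj (ecomp g F) q \<le> ereal (q \<bullet> x0 - c)"
        unfolding fenchel_conj_le_iff ecomp_le_iff using q' by (force simp: inner_diff_right)
      moreover have "ereal (q \<bullet> x0) - ecomp g F x0 \<le> fenchel_conj (ecomp g F) q"
        unfolding fenchel_conj_def by (rule SUP_upper) simp
      then have "ereal (q \<bullet> x0 - c) \<le> fenchel_conj (ecomp g F) q"
        using z0 c by (simp add: ecomp_def)
      ultimately have "fenchel_conj (ecomp g F) q = ereal (q \<bullet> x0 - c)" by (rule order.antisym)
      from mult[OF this] obtain v where v: "\<And>x z y r. F x = Some z \<Longrightarrow> g y \<le> ereal r \<Longrightarrow>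
          (q \<bullet> x - v \<bullet> z) + (v \<bullet> y - r) \<le> q \<bullet> x0 - c" by blast
      \<comment> \<open>Freezing \<open>x = x0\<close> in the multiplier inequality leaves the
        subgradient inequality of \<open>g\<close> at \<open>z0\<close>.\<close>
      have "g z0 + ereal (v \<bullet> (y - z0)) \<le> g y" for y
      proof (cases "g y")
        case (real r)
        then show ?thesis using v[OF z0, of y r] c by (simp add: inner_diff_right)
      qed (use g_finite in auto)
      then have "v \<in> subdiff g z0" by (simp add: subdiff_def)
      \<comment> \<open>Freezing \<open>y = z0\<close> and \<open>r = c\<close> instead leaves that
        of \<open>scalarize v F\<close> at \<open>x0\<close>.\<close>
      moreover have "scalarize v F x0 + ereal (q \<bullet> (x - x0)) \<le> scalarize v F x" for x
      proof (cases "F x")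
        case (Some z)
        then show ?thesis using v[OF Some, of z0 c] c z0
          by (simp add: scalarize_def inner_diff_right)
      qed (simp add: scalarize_def)
      then have "q \<in> subdiff (scalarize v F) x0" by (simp add: subdiff_def)
      ultimately show ?thesis by blast
    qed
    moreover have "q \<in> subdiff (ecomp g F) x0"
      if v: "v \<in> subdiff g z0" and q: "q \<in> subdiff (scalarize v F) x0" for v q
    proof -
      \<comment> \<open>The two subgradient inequalities chain through
        \<open>v \<bullet> (z - z0)\<close>.\<close>
      have "ecomp g F x0 + ereal (q \<bullet> (x - x0)) \<le> ecomp g F x" for x
      proof (cases "F x")
        case (Some z)
        have "scalarize v F x0 + ereal (q \<bullet> (x - x0)) \<le> scalarize v F x"
          using q by (simp add: subdiff_def)
        then have "c + q \<bullet> (x - x0) \<le> c + v \<bullet> (z - z0)"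
          using Some z0 by (simp add: scalarize_def inner_diff_right)
        moreover have "g z0 + ereal (v \<bullet> (z - z0)) \<le> g z"
          using v by (simp add: subdiff_def)
        ultimately show ?thesis
          using Some z0 c by (cases "g z") (auto simp: ecomp_def)
      qed (simp add: ecomp_def)
      then show ?thesis by (simp add: subdiff_def)
    qed
    ultimately show ?thesis using z0 by auto
  qed
  with conj show ?thesis by blast
qed

end
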